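(* Let $\theta$ be a joint distribution of $(X_1,\dots,X_n,W)$, let $\epsilon\ge 0$, let $\mathbf{x}$ be a stimulus with $\Pr[\mathbf{X}=\mathbf{x}]>0$, and let $h,h'$ be two histories with $\mathbf{x}\in R_h\cap R_{h'}$ such that $(\theta,h)$ and $(\theta,h')$ are $\epsilon$-consensuses. Then $$c_{switch}(h\rightarrow h')\ \ge\ \ell\big(\Pr[h'\mid h],\Pr[h\mid h']\big),\qquad \ell(x,y)=\log\Big(\big(1+\tfrac{x}{y}-x\big)\big(1+\tfrac{y}{x}-y\big)\Big).$$ Moreover, if $c_{switch}(h\rightarrow h')\le b$ for some $b\in[0,1]$, then $$D_{TV}(\mathbf{q}_h,\mathbf{q}_{h'})\ \le\ \min\Big\{2(1-2^{-b}),\ \sqrt{2^{b+1}\,g(\theta,\mathbf{x},\epsilon)}\Big\}.$$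
   Context: All logarithms are in base $2$. $X_1,\dots,X_n,W$ are random variables with finite realization spaces $\mathcal{S}_1,\dots,\mathcal{S}_n,\Omega$; the information structure $\theta$ is their joint distribution, and all probabilities are with respect to $\theta$. Write $\mathbf{X}=(X_1,\dots,X_n)$; a stimulus is a realization $\mathbf{x}=(x_1,\dots,x_n)$ of $\mathbf{X}$. A history $h$ is identified with a hyperrectangle $R_h=B_1\times\cdots\times B_n$ with $B_i\subset\mathcal{S}_i$; conditioning on $h$ means conditioning on the event $\{\mathbf{X}\in R_h\}$, which is assumed to have positive probability. $\Pr[h'\mid h]=\Pr[\mathbf{X}\in R_{h'}\mid \mathbf{X}\in R_h]$, $\mathbf{q}_h(\omega)=\Pr[W=\omega\mid h]$, and $\hat h\supset h$ means $R_{\hat h}\supset R_h$ (equality allowed). $\mathrm{I}(A;B\mid h)$ denotes the mutual information of $A$ and $B$ under the conditional distribution given the event $h$. $(\theta,h)$ achieves $\epsilon$-consensus if $\mathrm{I}(X_i;W\mid h)\le\epsilon$ for all $i=1,\dots,n$. The minimal switching cost from $h$ to $h'$ is $$c_{switch}(h\rightarrow h')=\min_{\hat h\supset h,h'}\Big(\log\frac{1}{\Pr[h\mid\hat h]}+\log\frac{1}{\Pr[h'\mid\hat h]}\Big),$$ the minimum being over histories $\hat h$ with $R_{\hat h}\supset R_h\cup R_{h'}$. The Gestalt complexity of the stimulus $\mathbf{x}$ is $$g(\theta,\mathbf{x},\epsilon)=\max\{\mathrm{I}(\mathbf{X};W\mid h): R_h\ni\mathbf{x},\ (\theta,h)\text{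 is an }\epsilon\text{-consensus}\}.$$ $D_{TV}(\mathbf{p},\mathbf{q})=\frac12\sum_{\omega}|\mathbf{p}(\omega)-\mathbf{q}(\omega)|$. *)

theory Defs
  imports "HOL-Probability.Probability"
begin

text \<open>
  The index set \<open>{1, ..., n}\<close> is the finite type \<open>'n\<close>, the realization space of \<open>W\<close> is the finite
  type \<open>'w\<close>, and the possibly different realization spaces of the \<open>X\<^sub>i\<close> are subsets \<open>S i\<close> of a
  common finite type \<open>'s\<close>. An information structure is the joint distribution of \<open>(X, W)\<close>; hence
  \<open>X = fst\<close>, \<open>X\<^sub>i = (\<lambda>z. fst z i)\<close> and \<open>W = snd\<close>.
\<close>

type_synonym ('n, 's, 'w) info_structure = "(('n \<Rightarrow> 's) \<times> 'w) pmf"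

definition info_structure_on ::
  "('n::finite \<Rightarrow> 's::finite set) \<Rightarrow> ('n, 's, 'w::finite) info_structure \<Rightarrow> bool" where
  "info_structure_on S \<theta> \<longleftrightarrow> set_pmf \<theta> \<subseteq> Pi UNIV S \<times> UNIV"

text \<open>A history is represented by its hyperrectangle.\<close>

definition history ::
  "('n::finite \<Rightarrow> 's::finite set) \<Rightarrow> ('n, 's, 'w::finite) info_structure \<Rightarrow> ('n \<Rightarrow> 's) set \<Rightarrow> bool" where
  "history S \<theta> R \<longleftrightarrow>
     (\<exists>B. (\<forall>i. B i \<subseteq> S i) \<and> R = Pi UNIV B) \<and> measure_pmf.prob \<theta> {z. fst z \<in> R} > 0"

text \<open>
  The conditional distribution given the event \<open>X \<in> R\<close>. Like \<^const>\<open>cond_pmf\<close>, it is meaningful only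
  if this event has positive probability, which holds for histories.
\<close>

definition given ::
  "('n::finite, 's::finite, 'w::finite) info_structure \<Rightarrow> ('n \<Rightarrow> 's) set \<Rightarrow> ('n, 's, 'w) info_structure" where
  "given \<theta> R = cond_pmf \<theta> {z. fst z \<in> R}"

definition history_prob ::
  "('n::finite, 's::finite, 'w::finite) info_structure \<Rightarrow> ('n \<Rightarrow> 's) set \<Rightarrow> ('n \<Rightarrow> 's) set \<Rightarrow> real"
  \<comment> \<open>\<open>history_prob \<theta> h' h\<close> is \<open>Pr[h' | h]\<close>\<close>
  where "history_prob \<theta> R' R = measure_pmf.prob (given \<theta> R) {z. fst z \<in> R'}"

definition posterior ::
  "('n::finite, 's::finite, 'w::finite) info_structure \<Rightarrow> ('n \<Rightarrow> 's) set \<Rightarrow> 'w \<Rightarrow> real" where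
  "posterior \<theta> R \<omega> = measure_pmf.prob (given \<theta> R) {z. snd z = \<omega>}"

text \<open>Mutual information in bits of two random variables under the conditional distribution.\<close>

definition mutual_info_given ::
  "('n::finite, 's::finite, 'w::finite) info_structure \<Rightarrow> ('n \<Rightarrow> 's) set \<Rightarrow>
   (('n \<Rightarrow> 's) \<times> 'w \<Rightarrow> 'a) \<Rightarrow> (('n \<Rightarrow> 's) \<times> 'w \<Rightarrow> 'b) \<Rightarrow> real" where
  "mutual_info_given \<theta> R A B =
     prob_space.mutual_information (measure_pmf (given \<theta> R)) 2
       (count_space (range A)) (count_space (range B)) A B"

definition consensus ::
  "('n::finite, 's::finite, 'w::finite) info_structure \<Rightarrow> ('n \<Rightarrow> 's) set \<Rightarrow> real \<Rightarrow> bool" where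
  "consensus \<theta> R \<epsilon> \<longleftrightarrow> (\<forall>i. mutual_info_given \<theta> R (\<lambda>z. fst z i) snd \<le> \<epsilon>)"

definition switching_cost ::
  "('n::finite \<Rightarrow> 's::finite set) \<Rightarrow> ('n, 's, 'w::finite) info_structure \<Rightarrow>
   ('n \<Rightarrow> 's) set \<Rightarrow> ('n \<Rightarrow> 's) set \<Rightarrow> real" where
  "switching_cost S \<theta> R R' =
     Min {log 2 (1 / history_prob \<theta> R T) + log 2 (1 / history_prob \<theta> R' T) | T.
            history S \<theta> T \<and> R \<union> R' \<subseteq> T}"

definition gestalt_complexity ::
  "('n::finite \<Rightarrow> 's::finite set) \<Rightarrow> ('n, 's, 'w::finite) info_structure \<Rightarrow>
   ('n \<Rightarrow> 's) \<Rightarrow> real \<Rightarrow> real" where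
  "gestalt_complexity S \<theta> x \<epsilon> =
     Max {mutual_info_given \<theta> R fst snd | R. history S \<theta> R \<and> x \<in> R \<and> consensus \<theta> R \<epsilon>}"

definition tv_dist :: "('w::finite \<Rightarrow> real) \<Rightarrow> ('w \<Rightarrow> real) \<Rightarrow> real" where
  "tv_dist p q = 1 / 2 * (\<Sum>\<omega>\<in>UNIV. \<bar>p \<omega> - q \<omega>\<bar>)"

definition ell :: "real \<Rightarrow> real \<Rightarrow> real" where
  "ell x y = log 2 ((1 + x / y - x) * (1 + y / x - y))"

end

theory Submission
  imports Defs
begin

text \<open>
  Only the masses of rectangles matter for the first bound: a history containing \<open>h\<close> and \<open>h'\<close> has
  mass at least \<open>Pr[h] + Pr[h'] - Pr[h \<inter> h']\<close>. For the second one, let \<open>\<alpha>\<close> and \<open>\<beta>\<close> be the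
  conditional probabilities of \<open>h\<close> and \<open>h'\<close> given an optimal \<open>T\<close>, so that \<open>\<alpha> \<beta> \<ge> 2 powr - b\<close>. The
  posteriors of \<open>h\<close> and \<open>h'\<close> are compared once through \<open>T\<close>, at total variation cost
  \<open>(1 - \<alpha>) + (1 - \<beta>)\<close>, and once through \<open>h \<inter> h'\<close>, where a localized Pinsker inequality bounds each
  of the two distances by \<open>sqrt (g / (2 Pr[h \<inter> h' | h]))\<close>, respectively with \<open>h'\<close> for \<open>h\<close>.
\<close>

section \<open>The scalar inequality behind Pinsker's bound\<close>

text \<open>Dividing the difference of the two sides by \<open>2 * x\<^sup>2 + 4 * x\<close> leaves
  \<open>ln x\<close> minus a rational function. Its derivative has the sign of
  \<open>x - 1\<close>, so its minimum is the value 0 at \<open>x = 1\<close>.\<close>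

lemma three_square_le_relative_entropy_real:
  fixes x :: real
  assumes "x > 0"
  shows "3 * (x - 1)\<^sup>2 \<le> (4 + 2 * x) * (x * ln x - x + 1)"
proof -
  define f where "f = (\<lambda>t::real. ln t - (5 * t\<^sup>2 - 4 * t - 1) / (2 * t\<^sup>2 + 4 * t))"
  have deriv: "(f has_real_derivative (t - 1) ^ 3 / (t\<^sup>2 * (t + 2)\<^sup>2)) (at t)" if "t > 0" for t
  proof -
    have nz: "2 * t\<^sup>2 + 4 * t \<noteq> 0"
      using that by (smt (verit) zero_less_power2)
    have eq: "1 / t - ((10 * t - 4) * (2 * t\<^sup>2 + 4 * t) - (5 * t\<^sup>2 - 4 * t - 1) * (4 * t + 4))
          / ((2 * t\<^sup>2 + 4 * t) * (2 * t\<^sup>2 + 4 * t)) = (t - 1) ^ 3 / (t\<^sup>2 * (t + 2)\<^sup>2)"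
    proof -
      have d: "(2 * t\<^sup>2 + 4 * t) * (2 * t\<^sup>2 + 4 * t) = 4 * (t\<^sup>2 * (t + 2)\<^sup>2)"
        by (simp add: power2_eq_square algebra_simps)
      have i: "1 / t = 4 * (t * (t + 2)\<^sup>2) / (4 * (t\<^sup>2 * (t + 2)\<^sup>2))"
        using that by (simp add: power2_eq_square)
      have j: "(t - 1) ^ 3 / (t\<^sup>2 * (t + 2)\<^sup>2) = 4 * (t - 1) ^ 3 / (4 * (t\<^sup>2 * (t + 2)\<^sup>2))"
        by simp
      show ?thesis
        unfolding d i j diff_divide_distrib[symmetric]
        by (rule arg_cong2[where f = "(/)"]) (simp_all add: power2_eq_square power3_eq_cube algebra_simps)
    qed
    show ?thesis
      unfolding f_def eq[symmetric]
      using that nz by (auto intro!: derivative_eq_intros simp: power2_eq_square)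
  qed
  have f1: "f 1 = 0"
    by (simp add: f_def)
  have "f x \<ge> 0"
  proof (cases "x \<ge> 1")
    case True
    have "f 1 \<le> f x"
    proof (rule DERIV_nonneg_imp_nondecreasing[OF True])
      fix t :: real assume "1 \<le> t"
      then show "\<exists>y. DERIV f t :> y \<and> y \<ge> 0"
        by (intro exI[of _ "(t - 1) ^ 3 / (t\<^sup>2 * (t + 2)\<^sup>2)"] conjI deriv) auto
    qed
    then show ?thesis using f1 by simp
  next
    case False
    then have "x \<le> 1" by simp
    then have "f x \<ge> f 1"
    proof (rule DERIV_nonpos_imp_nonincreasing)
      fix t :: real assume t: "x \<le> t" "t \<le> 1"
      have "(t - 1) ^ 3 \<le> 0"
        using t by (simp add: power3_eq_cube mult_le_0_iff)
      then have "(t - 1) ^ 3 / (t\<^sup>2 * (t + 2)\<^sup>2) \<le> 0"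
        by (intro divide_nonpos_nonneg) auto
      with t assms show "\<exists>y. DERIV f t :> y \<and> y \<le> 0"
        by (intro exI[of _ "(t - 1) ^ 3 / (t\<^sup>2 * (t + 2)\<^sup>2)"] conjI deriv) auto
    qed
    then show ?thesis using f1 by simp
  qed
  then have "0 \<le> (2 * x\<^sup>2 + 4 * x) * f x"
    using assms by simp
  also have "\<dots> = (4 + 2 * x) * (x * ln x - x + 1) - 3 * (x - 1)\<^sup>2"
  proof -
    have "2 * x\<^sup>2 + 4 * x \<noteq> 0"
      using assms by (smt (verit) zero_less_power2)
    then have "(2 * x\<^sup>2 + 4 * x) * f x = (2 * x\<^sup>2 + 4 * x) * ln x - (5 * x\<^sup>2 - 4 * x - 1)"
      by (simp add: f_def right_diff_distrib[of _ "ln x"])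
    then show ?thesis
      by (simp add: power2_eq_square algebra_simps)
  qed
  finally show ?thesis by simp
qed

text \<open>Homogeneous form of the scalar inequality: substitute \<open>x = p / q\<close> and
  multiply by \<open>q\<^sup>2\<close>.\<close>

lemma three_square_le_relative_entropy:
  fixes p q :: real
  assumes "p \<ge> 0" "q \<ge> 0" "q = 0 \<Longrightarrow> p = 0"
  shows "3 * (p - q)\<^sup>2 \<le> (4 * q + 2 * p) * (p * ln (p / q) - p + q)"
proof (cases "p = 0")
  \<comment> \<open>Here the claim reads \<open>3 * q\<^sup>2 \<le> 4 * q\<^sup>2\<close>; by the
    third assumption this also covers \<open>q = 0\<close>.\<close>
  case True
  then show ?thesis by (simp add: power2_eq_square)
next
  case False
  then have pq: "p > 0" "q > 0"
    using assms by (force simp: less_le)+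
  then have "3 * (p / q - 1)\<^sup>2 \<le> (4 + 2 * (p / q)) * (p / q * ln (p / q) - p / q + 1)"
    by (intro three_square_le_relative_entropy_real) simp
  then have "q\<^sup>2 * (3 * (p / q - 1)\<^sup>2) \<le>
      q\<^sup>2 * ((4 + 2 * (p / q)) * (p / q * ln (p / q) - p / q + 1))"
    by (intro mult_left_mono) auto
  also have "q\<^sup>2 * (3 * (p / q - 1)\<^sup>2) = 3 * (q * (p / q - 1))\<^sup>2"
    by (simp add: power_mult_distrib)
  also have "q * (p / q - 1) = p - q"
    using pq by (simp add: field_simps)
  also have "q\<^sup>2 * ((4 + 2 * (p / q)) * (p / q * ln (p / q) - p / q + 1)) =
      (q * (4 + 2 * (p / q))) * (q * (p / q * ln (p / q) - p / q + 1))"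
    by (simp add: power2_eq_square)
  also have "q * (4 + 2 * (p / q)) = 4 * q + 2 * p"
    using pq by (simp add: field_simps)
  also have "q * (p / q * ln (p / q) - p / q + 1) = p * ln (p / q) - p + q"
    using pq by (simp add: field_simps)
  finally show ?thesis .
qed

text \<open>The correction \<open>- p + q\<close> makes every summand of a relative entropy
  nonnegative on its own, so that sums may later be enlarged from a part of the space to all of it.
  For \<open>q \<noteq> 0\<close> the sign is read off the square bound, whose other factor is
  positive.\<close>

lemma relative_entropy_term_nonneg:
  fixes p q :: real
  assumes "p \<ge> 0" "q \<ge> 0" "q = 0 \<Longrightarrow> p = 0"
  shows "0 \<le> p * ln (p / q) - p + q"
proof (cases "q = 0")
  case True
  then show ?thesis using assms by simp
next
  case False
  then have "0 < 4 * q + 2 * p" using assms by simp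
  moreover have "0 \<le> (4 * q + 2 * p) * (p * ln (p / q) - p + q)"
    using three_square_le_relative_entropy[OF assms] by (smt (verit) zero_le_power2)
  ultimately show ?thesis by (simp add: zero_le_mult_iff)
qed

text \<open>Cauchy-Schwarz, applied to the square root of the pointwise inequality. The families may
  have any total mass, so that \<open>A\<close> can be a part of the space.\<close>

lemma sum_abs_square_le_relative_entropy:
  fixes p q :: "'a \<Rightarrow> real"
  assumes "\<And>z. z \<in> A \<Longrightarrow> p z \<ge> 0" "\<And>z. z \<in> A \<Longrightarrow> q z \<ge> 0"
    and "\<And>z. z \<in> A \<Longrightarrow> q z = 0 \<Longrightarrow> p z = 0"
  shows "(\<Sum>z\<in>A. \<bar>p z - q z\<bar>)\<^sup>2 \<le>
    (\<Sum>z\<in>A. (4 * q z + 2 * p z) / 3) * (\<Sum>z\<in>A. p z * ln (p z / q z) - p z + q z)"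
proof -
  let ?u = "\<lambda>z. (4 * q z + 2 * p z) / 3" and ?v = "\<lambda>z. p z * ln (p z / q z) - p z + q z"
  have uv: "0 \<le> ?u z" "0 \<le> ?v z" if "z \<in> A" for z
    using assms[OF that] relative_entropy_term_nonneg by auto
  have le: "\<bar>p z - q z\<bar> \<le> sqrt (?u z) * sqrt (?v z)" if "z \<in> A" for z
    unfolding real_sqrt_mult[symmetric]
    by (rule real_le_rsqrt) (use three_square_le_relative_entropy[OF assms[OF that]] in simp)
  have "(\<Sum>z\<in>A. \<bar>p z - q z\<bar>)\<^sup>2 \<le> (\<Sum>z\<in>A. sqrt (?u z) * sqrt (?v z))\<^sup>2"
    by (intro power_mono sum_mono le sum_nonneg) auto
  also have "\<dots> \<le> (\<Sum>z\<in>A. (sqrt (?u z))\<^sup>2) * (\<Sum>z\<in>A. (sqrt (?v z))\<^sup>2)"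
    by (rule Cauchy_Schwarz_ineq_sum)
  also have "\<dots> = (\<Sum>z\<in>A. ?u z) * (\<Sum>z\<in>A. ?v z)"
    using uv by simp
  finally show ?thesis .
qed

section \<open>Mutual information of finite joint laws and the localized Pinsker inequality\<close>

lemma simple_distributed_pmf:
  fixes r :: "'a::finite pmf"
  shows "simple_distributed (measure_pmf r) f (pmf (map_pmf f r))"
  by (rule measure_pmf.simple_distributedI) (simp_all add: simple_function_def pmf_map)

lemma mutual_information_pmf:
  fixes r :: "('a::finite \<times> 'b::finite) pmf"
  shows "prob_space.mutual_information (measure_pmf r) 2
      (count_space (range fst)) (count_space (range snd)) fst snd =
    (\<Sum>z\<in>UNIV. pmf r z * log 2 (pmf r z / (pmf (map_pmf fst r) (fst z) * pmf (map_pmf snd r) (snd z))))"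
proof -
  interpret information_space "measure_pmf r" 2
    by unfold_locales simp
  have img: "(\<lambda>z::'a \<times> 'b. (fst z, snd z)) ` UNIV = UNIV"
    by simp
  show ?thesis
    using mutual_information_simple_distributed[OF simple_distributed_pmf[of r fst]
      simple_distributed_pmf[of r snd] simple_distributed_pmf[of r "\<lambda>z. (fst z, snd z)"]]
    by (simp add: img case_prod_unfold)
qed

lemma pmf_le_marginals:
  shows "pmf r z \<le> pmf (map_pmf fst r) (fst z)" "pmf r z \<le> pmf (map_pmf snd r) (snd z)"
  by (auto simp: pmf_map measure_pmf_single[symmetric] intro!: measure_pmf.finite_measure_mono)

lemma sum_pmf_Times_UNIV:
  fixes r :: "('a::finite \<times> 'b::finite) pmf"
  shows "(\<Sum>z\<in>K \<times> UNIV. pmf r z) = measure_pmf.prob r {z. fst z \<in> K}"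
  by (subst measure_measure_pmf_finite[symmetric]) (auto intro!: arg_cong[where f = "measure_pmf.prob r"])

text \<open>The second marginal sums to 1, so the product law gives \<open>K \<times> UNIV\<close>
  the same mass as the joint law in \<open>sum_pmf_Times_UNIV\<close>. This equality determines the
  constant in \<open>local_pinsker\<close>.\<close>

lemma sum_product_of_marginals_Times_UNIV:
  fixes r :: "('a::finite \<times> 'b::finite) pmf"
  shows "(\<Sum>z\<in>K \<times> UNIV. pmf (map_pmf fst r) (fst z) * pmf (map_pmf snd r) (snd z)) =
    measure_pmf.prob r {z. fst z \<in> K}"
proof -
  have "(\<Sum>z\<in>K \<times> UNIV. pmf (map_pmf fst r) (fst z) * pmf (map_pmf snd r) (snd z)) =
      (\<Sum>x\<in>K. pmf (map_pmf fst r) x) * (\<Sum>w\<in>UNIV. pmf (map_pmf snd r) w)"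
    by (simp add: sum_product sum.cartesian_product case_prod_unfold)
  also have "(\<Sum>w\<in>UNIV. pmf (map_pmf snd r) w) = 1"
    by (rule sum_pmf_eq_1) auto
  also have "(\<Sum>x\<in>K. pmf (map_pmf fst r) x) = measure_pmf.prob r {z. fst z \<in> K}"
    by (subst measure_measure_pmf_finite[symmetric]) (auto simp: vimage_def)
  finally show ?thesis by simp
qed

text \<open>Pinsker's inequality for the joint law against the product of its marginals, localized to \<open>K\<close>.\<close>

lemma local_pinsker:
  fixes r :: "('a::finite \<times> 'b::finite) pmf"
  defines "I \<equiv> prob_space.mutual_information (measure_pmf r) 2
      (count_space (range fst)) (count_space (range snd)) fst snd"
  shows "(\<Sum>w\<in>UNIV. \<bar>measure_pmf.prob r {z. fst z \<in> K \<and> snd z = w} -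
        measure_pmf.prob r {z. fst z \<in> K} * measure_pmf.prob r {z. snd z = w}\<bar>)\<^sup>2
    \<le> 2 * measure_pmf.prob r {z. fst z \<in> K} * (ln 2 * I)"
proof -
  define m where "m = measure_pmf.prob r {z. fst z \<in> K}"
  let ?q = "\<lambda>z. pmf (map_pmf fst r) (fst z) * pmf (map_pmf snd r) (snd z)"
  let ?v = "\<lambda>z. pmf r z * ln (pmf r z / ?q z) - pmf r z + ?q z"
  \<comment> \<open>Absolute continuity: both marginals dominate the joint mass.\<close>
  have ac: "pmf r z = 0" if "?q z = 0" for z
    using that pmf_le_marginals[of r z] pmf_nonneg[of r z] by auto
  have v: "0 \<le> ?v z" for z
    by (intro relative_entropy_term_nonneg ac) auto
  \<comment> \<open>The factor \<open>ln 2\<close> turns bits into nats.\<close>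
  have "ln 2 * I = (\<Sum>z\<in>UNIV. pmf r z * ln (pmf r z / ?q z))"
    unfolding I_def mutual_information_pmf by (simp add: sum_distrib_left log_def)
  \<comment> \<open>Both laws have total mass 1, so the corrections in \<open>?v\<close>
    cancel.\<close>
  also have "\<dots> = (\<Sum>z\<in>UNIV. ?v z)"
    using sum_pmf_Times_UNIV[of r UNIV] sum_product_of_marginals_Times_UNIV[of r UNIV]
    by (simp add: sum.distrib sum_subtractf)
  finally have I: "ln 2 * I = (\<Sum>z\<in>UNIV. ?v z)" .
  \<comment> \<open>Triangle inequality over the cells \<open>(x, w)\<close> with \<open>x\<close>
    in \<open>K\<close>.\<close>
  have row: "\<bar>measure_pmf.prob r {z. fst z \<in> K \<and> snd z = w} -
        m * measure_pmf.prob r {z. snd z = w}\<bar> \<le> (\<Sum>x\<in>K. \<bar>pmf r (x, w) - ?q (x, w)\<bar>)" for w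
  proof -
    have "measure_pmf.prob r {z. fst z \<in> K \<and> snd z = w} = measure_pmf.prob r ((\<lambda>x. (x, w)) ` K)"
      by (rule arg_cong[where f = "measure_pmf.prob r"]) auto
    also have "\<dots> = (\<Sum>x\<in>K. pmf r (x, w))"
      by (simp add: measure_measure_pmf_finite sum.reindex inj_on_def)
    finally have 1: "measure_pmf.prob r {z. fst z \<in> K \<and> snd z = w} = (\<Sum>x\<in>K. pmf r (x, w))" .
    have 2: "m = (\<Sum>x\<in>K. pmf (map_pmf fst r) x)"
      unfolding m_def by (subst measure_measure_pmf_finite[symmetric]) (auto simp: vimage_def)
    have 3: "measure_pmf.prob r {z. snd z = w} = pmf (map_pmf snd r) w"
      by (simp add: pmf_map vimage_def)
    show ?thesis
      unfolding 1 2 3 sum_distrib_right sum_subtractf[symmetric] by (simp add: sum_abs)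
  qed
  have "(\<Sum>w\<in>UNIV. \<bar>measure_pmf.prob r {z. fst z \<in> K \<and> snd z = w} -
        m * measure_pmf.prob r {z. snd z = w}\<bar>) \<le> (\<Sum>w\<in>UNIV. \<Sum>x\<in>K. \<bar>pmf r (x, w) - ?q (x, w)\<bar>)"
    by (intro sum_mono row)
  also have "\<dots> = (\<Sum>z\<in>K \<times> UNIV. \<bar>pmf r z - ?q z\<bar>)"
    by (subst sum.swap) (simp add: sum.cartesian_product case_prod_unfold)
  finally have "(\<Sum>w\<in>UNIV. \<bar>measure_pmf.prob r {z. fst z \<in> K \<and> snd z = w} -
        m * measure_pmf.prob r {z. snd z = w}\<bar>)\<^sup>2 \<le> (\<Sum>z\<in>K \<times> UNIV. \<bar>pmf r z - ?q z\<bar>)\<^sup>2"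
    by (intro power_mono sum_nonneg) auto
  also have "\<dots> \<le> (\<Sum>z\<in>K \<times> UNIV. (4 * ?q z + 2 * pmf r z) / 3) * (\<Sum>z\<in>K \<times> UNIV. ?v z)"
    by (intro sum_abs_square_le_relative_entropy ac) auto
  \<comment> \<open>Both laws give the strip mass \<open>m\<close>, and
    \<open>(4 * m + 2 * m) / 3 = 2 * m\<close>.\<close>
  also have "(\<Sum>z\<in>K \<times> UNIV. (4 * ?q z + 2 * pmf r z) / 3) = 2 * m"
    unfolding sum_divide_distrib[symmetric] sum.distrib sum_distrib_left[symmetric]
      sum_pmf_Times_UNIV sum_product_of_marginals_Times_UNIV
    by (simp add: m_def)
  \<comment> \<open>Only the entropy factor is extended to the whole space, using
    \<open>?v z \<ge> 0\<close>. The factor \<open>m\<close> survives, which is the gain over the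
    global inequality.\<close>
  also have "2 * m * (\<Sum>z\<in>K \<times> UNIV. ?v z) \<le> 2 * m * (\<Sum>z\<in>UNIV. ?v z)"
    by (intro mult_left_mono sum_mono2 v) (auto simp: m_def)
  finally show ?thesis
    unfolding I m_def .
qed

section \<open>Masses of rectangles and conditional probabilities\<close>

text \<open>Unnormalized masses are monotone in the set and turn every conditional quantity into a
  quotient, see \<open>history_prob_eq\<close> and \<open>posterior_eq\<close>.\<close>

definition rect_prob ::
  "('n::finite, 's::finite, 'w::finite) info_structure \<Rightarrow> ('n \<Rightarrow> 's) set \<Rightarrow> real" where
  "rect_prob \<theta> R = measure_pmf.prob \<theta> {z. fst z \<in> R}"

definition rect_joint ::
  "('n::finite, 's::finite, 'w::finite) info_structure \<Rightarrow> ('n \<Rightarrow> 's) set \<Rightarrow> 'w \<Rightarrow> real" where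
  "rect_joint \<theta> R \<omega> = measure_pmf.prob \<theta> {z. fst z \<in> R \<and> snd z = \<omega>}"

lemma rect_prob_mono: "R \<subseteq> T \<Longrightarrow> rect_prob \<theta> R \<le> rect_prob \<theta> T"
  unfolding rect_prob_def by (intro measure_pmf.finite_measure_mono) auto

lemma rect_joint_mono: "R \<subseteq> T \<Longrightarrow> rect_joint \<theta> R \<omega> \<le> rect_joint \<theta> T \<omega>"
  unfolding rect_joint_def by (intro measure_pmf.finite_measure_mono) auto

lemma rect_joint_nonneg: "0 \<le> rect_joint \<theta> R \<omega>"
  by (simp add: rect_joint_def)

lemma sum_rect_joint: "(\<Sum>\<omega>\<in>UNIV. rect_joint \<theta> R \<omega>) = rect_prob \<theta> R"
proof -
  have "(\<Sum>\<omega>\<in>UNIV. rect_joint \<theta> R \<omega>) =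
      measure_pmf.prob \<theta> (\<Union>\<omega>. {z. fst z \<in> R \<and> snd z = \<omega>})"
    unfolding rect_joint_def
    by (rule measure_pmf.finite_measure_finite_Union[symmetric]) (auto simp: disjoint_family_on_def)
  also have "(\<Union>\<omega>. {z. fst z \<in> R \<and> snd z = \<omega>}) = {z. fst z \<in> R}" by auto
  finally show ?thesis by (simp add: rect_prob_def)
qed

lemma rect_prob_union_le:
  assumes "R \<union> R' \<subseteq> T"
  shows "rect_prob \<theta> R + rect_prob \<theta> R' - rect_prob \<theta> (R \<inter> R') \<le> rect_prob \<theta> T"
proof -
  have "rect_prob \<theta> (R \<union> R') = rect_prob \<theta> R + rect_prob \<theta> R' - rect_prob \<theta> (R \<inter> R')"
    using measure_pmf.finite_measure_Union'[of "{z. fst z \<in> R}" \<theta> "{z. fst z \<in> R'}"]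
      measure_pmf.finite_measure_Diff'[of "{z. fst z \<in> R'}" \<theta> "{z. fst z \<in> R}"]
    unfolding rect_prob_def by (simp add: Collect_disj_eq Collect_conj_eq Int_commute)
  with rect_prob_mono[OF assms, of \<theta>] show ?thesis by simp
qed

lemma prob_given:
  assumes "rect_prob \<theta> R > 0"
  shows "measure_pmf.prob (given \<theta> R) A = measure_pmf.prob \<theta> ({z. fst z \<in> R} \<inter> A) / rect_prob \<theta> R"
proof -
  \<comment> \<open>Positive mass makes the event meet the support, the condition under which
    \<open>cond_pmf\<close> is specified.\<close>
  have "set_pmf \<theta> \<inter> {z. fst z \<in> R} \<noteq> {}"
    using assms measure_Int_set_pmf[of \<theta> "{z. fst z \<in> R}"]
    by (auto simp: rect_prob_def Int_commute)
  then have "pmf (given \<theta> R) z = (if fst z \<in> R then pmf \<theta> z / rect_prob \<theta> R else 0)" for z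
    by (simp add: given_def pmf_cond rect_prob_def)
  then have "measure_pmf.prob (given \<theta> R) A =
      (\<Sum>z\<in>A. if z \<in> {z. fst z \<in> R} then pmf \<theta> z / rect_prob \<theta> R else 0)"
    by (simp add: measure_measure_pmf_finite)
  also have "\<dots> = (\<Sum>z\<in>A \<inter> {z. fst z \<in> R}. pmf \<theta> z / rect_prob \<theta> R)"
    by (rule sum.inter_restrict[symmetric]) simp
  also have "\<dots> = measure_pmf.prob \<theta> (A \<inter> {z. fst z \<in> R}) / rect_prob \<theta> R"
    by (simp only: measure_measure_pmf_finite[OF finite] sum_divide_distrib)
  finally show ?thesis
    by (simp only: Int_commute)
qed

lemma history_prob_eq:
  assumes "rect_prob \<theta> R > 0"
  shows "history_prob \<theta> R' R = rect_prob \<theta> (R \<inter> R') / rect_prob \<theta> R"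
  unfolding history_prob_def prob_given[OF assms] by (simp add: rect_prob_def Collect_conj_eq)

lemma posterior_eq:
  assumes "rect_prob \<theta> R > 0"
  shows "posterior \<theta> R \<omega> = rect_joint \<theta> R \<omega> / rect_prob \<theta> R"
  unfolding posterior_def prob_given[OF assms] by (simp add: rect_joint_def Collect_conj_eq)

section \<open>Total variation between posteriors of nested events\<close>

lemma tv_dist_triangle: "tv_dist p r \<le> tv_dist p q + tv_dist q r"
proof -
  have "(\<Sum>\<omega>\<in>UNIV. \<bar>p \<omega> - r \<omega>\<bar>) \<le> (\<Sum>\<omega>\<in>UNIV. \<bar>p \<omega> - q \<omega>\<bar> + \<bar>q \<omega> - r \<omega>\<bar>)"
    by (intro sum_mono) auto
  then show ?thesis
    by (simp add: tv_dist_def sum.distrib)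
qed

lemma tv_dist_commute: "tv_dist p q = tv_dist q p"
  by (simp add: tv_dist_def abs_minus_commute)

text \<open>The difference of the posteriors splits into two nonnegative parts of opposite sign: the
  mass of \<open>R\<close> rescaled from \<open>1 / t\<close> to \<open>1 / a\<close>, and the mass
  of \<open>T\<close> outside \<open>R\<close>. Each part has total
  \<open>1 - a / t\<close>.\<close>

lemma tv_dist_posterior_mono:
  assumes "R \<subseteq> T" and a: "rect_prob \<theta> R > 0"
  shows "tv_dist (posterior \<theta> R) (posterior \<theta> T) \<le> 1 - rect_prob \<theta> R / rect_prob \<theta> T"
proof -
  define a t where "a = rect_prob \<theta> R" and "t = rect_prob \<theta> T"
  have at: "0 < a" "a \<le> t" "0 < t"
    using a rect_prob_mono[OF assms(1), of \<theta>] by (auto simp: a_def t_def)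
  have "\<bar>posterior \<theta> R \<omega> - posterior \<theta> T \<omega>\<bar> \<le>
      rect_joint \<theta> R \<omega> * (1 / a - 1 / t) + (rect_joint \<theta> T \<omega> - rect_joint \<theta> R \<omega>) / t" for \<omega>
  proof -
    have "posterior \<theta> R \<omega> - posterior \<theta> T \<omega> =
        rect_joint \<theta> R \<omega> * (1 / a - 1 / t) - (rect_joint \<theta> T \<omega> - rect_joint \<theta> R \<omega>) / t"
      using at by (simp add: posterior_eq a_def t_def right_diff_distrib diff_divide_distrib)
    moreover have "0 \<le> rect_joint \<theta> R \<omega> * (1 / a - 1 / t)"
      using at by (intro mult_nonneg_nonneg rect_joint_nonneg) (simp add: frac_le)
    moreover have "0 \<le> (rect_joint \<theta> T \<omega> - rect_joint \<theta> R \<omega>) / t"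
      using at rect_joint_mono[OF assms(1), of \<theta> \<omega>] by simp
    ultimately show ?thesis by linarith
  qed
  then have "(\<Sum>\<omega>\<in>UNIV. \<bar>posterior \<theta> R \<omega> - posterior \<theta> T \<omega>\<bar>) \<le>
      (\<Sum>\<omega>\<in>UNIV. rect_joint \<theta> R \<omega> * (1 / a - 1 / t) + (rect_joint \<theta> T \<omega> - rect_joint \<theta> R \<omega>) / t)"
    by (rule sum_mono)
  also have "\<dots> = a * (1 / a - 1 / t) + (t - a) / t"
    by (simp add: sum.distrib sum_distrib_right[symmetric] sum_divide_distrib[symmetric]
        sum_subtractf sum_rect_joint a_def t_def)
  also have "\<dots> = 2 * (1 - a / t)"
    using at by (simp add: field_simps)
  finally show ?thesis
    by (simp add: tv_dist_def a_def t_def mult.commute)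
qed

text \<open>In the law given \<open>R\<close>, the set \<open>K\<close> has mass
  \<open>m / a\<close>, and the sum in \<open>local_pinsker\<close> equals \<open>m / a\<close>
  times twice the distance. Squaring gives two factors \<open>m / a\<close>, of which the localized
  right-hand side cancels one.\<close>

lemma tv_dist_posterior_le_mutual_info:
  assumes "K \<subseteq> R" and m: "rect_prob \<theta> K > 0"
  shows "2 * (tv_dist (posterior \<theta> K) (posterior \<theta> R))\<^sup>2 * (rect_prob \<theta> K / rect_prob \<theta> R)
    \<le> ln 2 * mutual_info_given \<theta> R fst snd"
proof -
  define m a where "m = rect_prob \<theta> K" and "a = rect_prob \<theta> R"
  have ma: "0 < m" "0 < a"
    using m rect_prob_mono[OF assms(1), of \<theta>] by (auto simp: a_def m_def)
  let ?r = "given \<theta> R" and ?D = "tv_dist (posterior \<theta> K) (posterior \<theta> R)"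
  have R: "R \<inter> K = K" using assms by auto
  have 1: "measure_pmf.prob ?r {z. fst z \<in> K} = m / a"
    using history_prob_eq[of \<theta> R K] ma by (simp add: history_prob_def R m_def a_def)
  have 2: "measure_pmf.prob ?r {z. fst z \<in> K \<and> snd z = \<omega>} = m / a * posterior \<theta> K \<omega>" for \<omega>
  proof -
    have "{z. fst z \<in> R} \<inter> {z. fst z \<in> K \<and> snd z = \<omega>} = {z. fst z \<in> K \<and> snd z = \<omega>}"
      using assms by auto
    then show ?thesis
      using ma by (simp add: prob_given posterior_eq a_def m_def rect_joint_def)
  qed
  have "\<bar>m / a * p - m / a * q\<bar> = m / a * \<bar>p - q\<bar>" for p q :: real
    using ma by (simp only: right_diff_distrib[symmetric] abs_mult) simp
  then have "(\<Sum>\<omega>\<in>UNIV. \<bar>m / a * posterior \<theta> K \<omega> - m / a * posterior \<theta> R \<omega>\<bar>) = m / a * (2 * ?D)"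
    by (simp only: sum_distrib_left[symmetric]) (simp add: tv_dist_def)
  then have "(m / a * (2 * ?D))\<^sup>2 \<le> 2 * (m / a) * (ln 2 * mutual_info_given \<theta> R fst snd)"
    using local_pinsker[of ?r K]
    by (simp add: 1 2 posterior_def[of \<theta> R, symmetric] mutual_info_given_def)
  then have "2 * (m / a) * (2 * ?D\<^sup>2 * (m / a)) \<le>
      2 * (m / a) * (ln 2 * mutual_info_given \<theta> R fst snd)"
    by (simp add: power2_eq_square algebra_simps)
  moreover have "0 < 2 * (m / a)"
    using ma by simp
  ultimately have "2 * ?D\<^sup>2 * (m / a) \<le> ln 2 * mutual_info_given \<theta> R fst snd"
    by (simp only: mult_le_cancel_left_pos)
  then show ?thesis by (simp add: m_def a_def)
qed

section \<open>The extremal quantities: Gestalt complexity and switching cost\<close>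

lemma mutual_info_le_gestalt_complexity:
  assumes "history S \<theta> R" "x \<in> R" "consensus \<theta> R \<epsilon>"
  shows "mutual_info_given \<theta> R fst snd \<le> gestalt_complexity S \<theta> x \<epsilon>"
  unfolding gestalt_complexity_def
proof (rule Max_ge)
  have "{mutual_info_given \<theta> R fst snd |R. history S \<theta> R \<and> x \<in> R \<and> consensus \<theta> R \<epsilon>} \<subseteq>
      (\<lambda>R. mutual_info_given \<theta> R fst snd) ` UNIV" by auto
  then show "finite {mutual_info_given \<theta> R fst snd |R. history S \<theta> R \<and> x \<in> R \<and> consensus \<theta> R \<epsilon>}"
    by (rule finite_subset) simp
qed (use assms in auto)

lemma history_rect_prob_pos: "history S \<theta> R \<Longrightarrow> rect_prob \<theta> R > 0"
  by (simp add: history_def rect_prob_def)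

lemma history_subset: "history S \<theta> R \<Longrightarrow> R \<subseteq> Pi UNIV S"
  unfolding history_def by (elim conjE exE) (simp add: Pi_mono)

text \<open>The full rectangle \<open>Pi UNIV S\<close> is a candidate and there are finitely many
  candidates, so the minimum is attained; its two logarithms merge into one.\<close>

lemma switching_cost_attained:
  assumes "info_structure_on S \<theta>" "history S \<theta> h" "history S \<theta> h'"
  obtains T where "history S \<theta> T" "h \<union> h' \<subseteq> T"
    "switching_cost S \<theta> h h' =
      log 2 ((rect_prob \<theta> T)\<^sup>2 / (rect_prob \<theta> h * rect_prob \<theta> h'))"
proof -
  let ?c = "\<lambda>T. log 2 (1 / history_prob \<theta> h T) + log 2 (1 / history_prob \<theta> h' T)"
  let ?C = "{?c T |T. history S \<theta> T \<and> h \<union> h' \<subseteq> T}"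
  have sub: "h \<union> h' \<subseteq> Pi UNIV S"
    using history_subset[OF assms(2)] history_subset[OF assms(3)] by simp
  then have "rect_prob \<theta> (Pi UNIV S) > 0"
    using history_rect_prob_pos[OF assms(2)] rect_prob_mono[of h "Pi UNIV S" \<theta>] by simp
  then have "history S \<theta> (Pi UNIV S)"
    by (auto simp: history_def rect_prob_def)
  with sub have "?C \<noteq> {}" by blast
  moreover have "finite ?C"
    by (rule finite_subset[of _ "?c ` UNIV"]) auto
  ultimately have "Min ?C \<in> ?C" by (rule Min_in[rotated])
  then obtain T where T: "history S \<theta> T" "h \<union> h' \<subseteq> T" "Min ?C = ?c T" by blast
  have pos: "rect_prob \<theta> T > 0" "rect_prob \<theta> h > 0" "rect_prob \<theta> h' > 0"
    using T assms history_rect_prob_pos by auto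
  have "T \<inter> h = h" "T \<inter> h' = h'" using T by auto
  then have "?c T = log 2 (rect_prob \<theta> T / rect_prob \<theta> h) + log 2 (rect_prob \<theta> T / rect_prob \<theta> h')"
    using pos by (simp add: history_prob_eq)
  also have "\<dots> = log 2 ((rect_prob \<theta> T)\<^sup>2 / (rect_prob \<theta> h * rect_prob \<theta> h'))"
    using pos by (simp add: log_mult log_divide power2_eq_square)
  finally show thesis
    using that T by (simp add: switching_cost_def)
qed

text \<open>
  Here \<open>\<alpha>\<close>, \<open>\<beta>\<close> and \<open>m\<close> are the masses of \<open>h\<close>, \<open>h'\<close> and \<open>h \<inter> h'\<close> relative to \<open>T\<close>, and \<open>c\<close> is
  \<open>2 powr b\<close>. With \<open>u = \<alpha> + \<beta>\<close> the claim reduces to \<open>u ^ 3 \<le> 8 * (u - 1)\<close>, that is to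
  \<open>(2 - u) * (u\<^sup>2 + 2 * u - 4) \<ge> 0\<close>.
\<close>

lemma overlap_arithmetic:
  fixes \<alpha> \<beta> m c :: real
  assumes "0 < \<alpha>" "\<alpha> \<le> 1" "0 < \<beta>" "\<beta> \<le> 1" "\<alpha> + \<beta> - 1 \<le> m" "0 < m" "1 \<le> c * (\<alpha> * \<beta>)" "0 < c" "c \<le> 2"
  shows "\<alpha> / m + \<beta> / m \<le> 2 * c"
proof -
  define u where "u = \<alpha> + \<beta>"
  have u2: "4 * (\<alpha> * \<beta>) \<le> u\<^sup>2"
    using zero_le_power2[of "\<alpha> - \<beta>"] by (simp add: u_def power2_eq_square algebra_simps)
  \<comment> \<open>The bound \<open>c \<le> 2\<close>, which stands for \<open>b \<le> 1\<close>,
    keeps \<open>u\<close> away from 1.\<close>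
  have "c * (\<alpha> * \<beta>) \<le> 2 * (\<alpha> * \<beta>)"
    using assms by (intro mult_right_mono) auto
  with u2 assms have "2 \<le> u\<^sup>2" by linarith
  then have u1: "5 / 4 \<le> u"
  proof -
    \<comment> \<open>A rational value below the square root of 2 suffices: with
      \<open>u\<^sup>2 \<ge> 2\<close> it gives
      \<open>u\<^sup>2 + 2 * u - 4 \<ge> 1 / 2\<close>.\<close>
    have "(5 / 4)\<^sup>2 \<le> u\<^sup>2" using \<open>2 \<le> u\<^sup>2\<close> by (simp add: power2_eq_square)
    then show ?thesis
      by (rule power2_le_imp_le) (use assms in \<open>simp add: u_def\<close>)
  qed
  have u3: "u \<le> 2" using assms by (simp add: u_def)
  have cu: "4 \<le> c * u\<^sup>2"
  proof -
    have "4 \<le> c * (4 * (\<alpha> * \<beta>))" using assms by simp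
    also have "\<dots> \<le> c * u\<^sup>2" using u2 assms by (intro mult_left_mono) auto
    finally show ?thesis .
  qed
  have "0 \<le> (2 - u) * (u\<^sup>2 + 2 * u - 4)"
    using u1 u3 \<open>2 \<le> u\<^sup>2\<close> by (intro mult_nonneg_nonneg) linarith+
  then have cube: "u * u\<^sup>2 \<le> 8 * (u - 1)"
    by (simp add: power2_eq_square algebra_simps)
  have "u * u\<^sup>2 \<le> 2 * 4 * (u - 1)"
    using cube by simp
  \<comment> \<open>Inserting \<open>4 \<le> c * u\<^sup>2\<close> makes \<open>u\<^sup>2\<close> a
    common factor, which is then cancelled.\<close>
  also have "\<dots> \<le> 2 * (c * u\<^sup>2) * (u - 1)"
    using cu u1 by (intro mult_right_mono) auto
  finally have "u\<^sup>2 * u \<le> u\<^sup>2 * (2 * c * (u - 1))"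
    by (simp add: algebra_simps)
  then have "u \<le> 2 * c * (u - 1)"
    using \<open>2 \<le> u\<^sup>2\<close> by (subst (asm) mult_le_cancel_left_pos) auto
  also have "\<dots> \<le> 2 * c * m"
    using assms by (intro mult_left_mono) (auto simp: u_def)
  finally show ?thesis
    using assms by (simp add: u_def field_simps)
qed

section \<open>The lower bound on the switching cost and the two distance bounds\<close>

text \<open>With \<open>x = m / a\<close> and \<open>y = m / a'\<close>, the number
  \<open>ell x y\<close> is the cost of passing through an event of mass exactly
  \<open>a + a' - m\<close>, the mass of \<open>h \<union> h'\<close>. Any admissible
  \<open>T\<close> is at least as heavy.\<close>

lemma ell_le_switching_cost:
  assumes S: "info_structure_on S \<theta>" "history S \<theta> h" "history S \<theta> h'"
    and pos: "rect_prob \<theta> (h \<inter> h') > 0"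
  shows "ell (history_prob \<theta> h' h) (history_prob \<theta> h h') \<le> switching_cost S \<theta> h h'"
proof -
  define a a' m where "a = rect_prob \<theta> h" and "a' = rect_prob \<theta> h'" and "m = rect_prob \<theta> (h \<inter> h')"
  obtain T where T: "h \<union> h' \<subseteq> T"
    and cost: "switching_cost S \<theta> h h' = log 2 ((rect_prob \<theta> T)\<^sup>2 / (a * a'))"
    using switching_cost_attained[OF S] unfolding a_def a'_def by metis
  have p: "0 < m" "m \<le> a" "m \<le> a'"
    using pos rect_prob_mono[of "h \<inter> h'"] by (auto simp: m_def a_def a'_def)
  have x: "history_prob \<theta> h' h = m / a" "history_prob \<theta> h h' = m / a'"
    using p by (simp_all add: history_prob_eq a_def a'_def m_def Int_commute)
  have "(1 + m / a / (m / a') - m / a) * (1 + m / a' / (m / a) - m / a') =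
      ((a + a' - m) / a) * ((a + a' - m) / a')"
    using p by (intro arg_cong2[where f = "(*)"]) (simp_all add: field_simps)
  also have "\<dots> = (a + a' - m)\<^sup>2 / (a * a')"
    by (simp add: power2_eq_square)
  finally have ell: "ell (history_prob \<theta> h' h) (history_prob \<theta> h h') =
      log 2 ((a + a' - m)\<^sup>2 / (a * a'))"
    unfolding ell_def x by simp
  have le: "a + a' - m \<le> rect_prob \<theta> T"
    using rect_prob_union_le[OF T, of \<theta>] by (simp add: a_def a'_def m_def)
  have "0 < (a + a' - m)\<^sup>2 / (a * a')"
    using p by simp
  moreover have "(a + a' - m)\<^sup>2 / (a * a') \<le> (rect_prob \<theta> T)\<^sup>2 / (a * a')"
    using p le by (intro divide_right_mono power_mono) auto
  ultimately show ?thesis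
    unfolding ell cost by (simp add: log_mono)
qed

text \<open>The number \<open>g\<close> is any common bound on the two informations; the theorem
  takes the Gestalt complexity.\<close>

lemma tv_dist_le_of_switching_cost:
  assumes S: "info_structure_on S \<theta>" "history S \<theta> h" "history S \<theta> h'"
    and pos: "rect_prob \<theta> (h \<inter> h') > 0"
    and b: "0 \<le> b" "b \<le> 1" "switching_cost S \<theta> h h' \<le> b"
    and g: "mutual_info_given \<theta> h fst snd \<le> g" "mutual_info_given \<theta> h' fst snd \<le> g"
  shows "tv_dist (posterior \<theta> h) (posterior \<theta> h') \<le> 2 * (1 - 2 powr (- b))" (is "?D \<le> _")
    and "tv_dist (posterior \<theta> h) (posterior \<theta> h') \<le> sqrt (2 powr (b + 1) * g)"
proof -
  define a a' m where "a = rect_prob \<theta> h" and "a' = rect_prob \<theta> h'" and "m = rect_prob \<theta> (h \<inter> h')"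
  obtain T where T: "h \<union> h' \<subseteq> T"
    and cost: "switching_cost S \<theta> h h' = log 2 ((rect_prob \<theta> T)\<^sup>2 / (a * a'))"
    using switching_cost_attained[OF S] unfolding a_def a'_def by metis
  define t where "t = rect_prob \<theta> T"
  have p: "0 < m" "m \<le> a" "m \<le> a'" "a \<le> t" "a' \<le> t"
    using pos T rect_prob_mono[of "h \<inter> h'"] rect_prob_mono[of _ T]
    by (auto simp: m_def a_def a'_def t_def)
  have t: "0 < t" "0 < a" "0 < a'" using p by linarith+
  define \<alpha> \<beta> where "\<alpha> = a / t" and "\<beta> = a' / t"
  have \<alpha>\<beta>: "0 < \<alpha>" "\<alpha> \<le> 1" "0 < \<beta>" "\<beta> \<le> 1"
    using p t by (auto simp: \<alpha>_def \<beta>_def)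
  \<comment> \<open>The left side is \<open>1 / (\<alpha> * \<beta>)\<close>.\<close>
  have "t\<^sup>2 / (a * a') \<le> 2 powr b"
    using b(3) t unfolding cost t_def[symmetric] by (subst (asm) log_le_iff) auto
  then have prod: "1 \<le> 2 powr b * (\<alpha> * \<beta>)"
    using t by (simp add: \<alpha>_def \<beta>_def field_simps power2_eq_square)
  \<comment> \<open>By AM-GM, \<open>\<alpha> + \<beta>\<close> is at least twice the root of
    \<open>2 powr (- b)\<close>, and a number in [0,1] is at most its root.\<close>
  have sum_ge: "2 * 2 powr (- b) \<le> \<alpha> + \<beta>"
  proof (rule power2_le_imp_le)
    let ?s = "2 powr (- b)"
    have s: "0 < ?s" "?s \<le> 1" using b(1) powr_mono[of "- b" 0 2] by auto
    have "2 powr b * ?s = 1" by (simp add: powr_add[symmetric])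
    then have "?s * 1 \<le> \<alpha> * \<beta>"
      using mult_left_mono[OF prod, of ?s] s by (simp add: algebra_simps)
    moreover have "?s\<^sup>2 \<le> ?s" using s by (simp add: power2_eq_square mult_left_le)
    moreover have "4 * (\<alpha> * \<beta>) \<le> (\<alpha> + \<beta>)\<^sup>2"
      using zero_le_power2[of "\<alpha> - \<beta>"] by (simp add: power2_eq_square algebra_simps)
    moreover have "(2 * ?s)\<^sup>2 = 4 * ?s\<^sup>2" by (simp add: power_mult_distrib)
    ultimately show "(2 * ?s)\<^sup>2 \<le> (\<alpha> + \<beta>)\<^sup>2"
      by linarith
  qed (use \<alpha>\<beta> in simp)
  have "?D \<le> tv_dist (posterior \<theta> h) (posterior \<theta> T) + tv_dist (posterior \<theta> T) (posterior \<theta> h')"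
    by (rule tv_dist_triangle)
  also have "\<dots> \<le> (1 - \<alpha>) + (1 - \<beta>)"
    using tv_dist_posterior_mono[of h T \<theta>] tv_dist_posterior_mono[of h' T \<theta>] T t
    by (auto simp: \<alpha>_def \<beta>_def a_def a'_def t_def tv_dist_commute[of "posterior \<theta> T"] intro!: add_mono)
  finally show "?D \<le> 2 * (1 - 2 powr (- b))"
    using sum_ge by simp

  define d d' where "d = tv_dist (posterior \<theta> (h \<inter> h')) (posterior \<theta> h)"
    and "d' = tv_dist (posterior \<theta> (h \<inter> h')) (posterior \<theta> h')"
  have d_le: "2 * d\<^sup>2 * (m / a) \<le> ln 2 * mutual_info_given \<theta> h fst snd"
    using tv_dist_posterior_le_mutual_info[of "h \<inter> h'" h \<theta>] pos by (simp add: d_def m_def a_def)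
  have d'_le: "2 * d'\<^sup>2 * (m / a') \<le> ln 2 * mutual_info_given \<theta> h' fst snd"
    using tv_dist_posterior_le_mutual_info[of "h \<inter> h'" h' \<theta>] pos by (simp add: d'_def m_def a'_def)
  have "0 \<le> 2 * d\<^sup>2 * (m / a)" using p t by simp
  \<comment> \<open>The Pinsker bound itself shows this: a nonnegative number is at most
    \<open>ln 2\<close> times an information that \<open>g\<close> dominates.\<close>
  then have g0: "0 \<le> g"
    using d_le g(1) by (smt (verit) ln_gt_zero mult_le_0_iff mult_pos_neg)
  \<comment> \<open>As \<open>ln 2 < 1\<close>, the conversion factor is dropped.\<close>
  have ln2: "ln 2 * y \<le> g" if "y \<le> g" for y :: real
  proof -
    have "ln 2 * y \<le> ln 2 * g" using that by (intro mult_left_mono) auto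
    also have "\<dots> \<le> 1 * g" using ln_2_less_1 g0 by (intro mult_right_mono) auto
    finally show ?thesis by simp
  qed
  have d2: "2 * d\<^sup>2 \<le> g * (a / m)"
    using order_trans[OF d_le ln2[OF g(1)]] p t by (simp add: field_simps)
  have d'2: "2 * d'\<^sup>2 \<le> g * (a' / m)"
    using order_trans[OF d'_le ln2[OF g(2)]] p t by (simp add: field_simps)
  have "?D \<le> d + d'"
    using tv_dist_triangle[of "posterior \<theta> h" "posterior \<theta> h'" "posterior \<theta> (h \<inter> h')"]
    by (simp add: d_def d'_def tv_dist_commute)
  moreover have "0 \<le> ?D" by (simp add: tv_dist_def sum_nonneg)
  ultimately have "?D\<^sup>2 \<le> (d + d')\<^sup>2" by (intro power_mono)
  also have "\<dots> \<le> 2 * d\<^sup>2 + 2 * d'\<^sup>2"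
    using zero_le_power2[of "d - d'"] by (simp add: power2_eq_square algebra_simps)
  also have "\<dots> \<le> g * (a / m + a' / m)"
    using d2 d'2 by (simp add: distrib_left)
  \<comment> \<open>Dividing all masses by \<open>t\<close> prepares
    \<open>overlap_arithmetic\<close>, with \<open>m / t\<close> for \<open>m\<close> and
    \<open>2 powr b\<close> for \<open>c\<close>.\<close>
  also have "a / m + a' / m = \<alpha> / (m / t) + \<beta> / (m / t)"
    using t by (simp add: \<alpha>_def \<beta>_def)
  also have "g * \<dots> \<le> g * (2 * 2 powr b)"
  proof (intro mult_left_mono overlap_arithmetic \<alpha>\<beta> prod g0)
    have "a + a' - m \<le> t"
      using rect_prob_union_le[OF T, of \<theta>] by (simp add: a_def a'_def m_def t_def)
    then have "(a + a' - m) / t \<le> 1"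
      using t by simp
    then show "\<alpha> + \<beta> - 1 \<le> m / t"
      by (simp add: \<alpha>_def \<beta>_def add_divide_distrib diff_divide_distrib)
    show "2 powr b \<le> 2"
      using powr_mono[OF b(2), of 2] by simp
  qed (use p t in auto)
  also have "\<dots> = 2 powr (b + 1) * g"
    by (simp add: powr_add)
  finally show "?D \<le> sqrt (2 powr (b + 1) * g)"
    by (rule real_le_rsqrt)
qed

theorem proposition5p3:
  fixes S :: "'n::finite \<Rightarrow> 's::finite set"
    and \<theta> :: "('n, 's, 'w::finite) info_structure"
    and \<epsilon> :: real
    and x :: "'n \<Rightarrow> 's"
    and h h' :: "('n \<Rightarrow> 's) set"
  assumes "info_structure_on S \<theta>"
    and "\<epsilon> \<ge> 0"
    and "measure_pmf.prob \<theta> {z. fst z = x} > 0"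
    and "history S \<theta> h" and "history S \<theta> h'"
    and "x \<in> h \<inter> h'"
    and "consensus \<theta> h \<epsilon>" and "consensus \<theta> h' \<epsilon>"
  shows "switching_cost S \<theta> h h' \<ge> ell (history_prob \<theta> h' h) (history_prob \<theta> h h') \<and>
    (\<forall>b\<in>{0..1}. switching_cost S \<theta> h h' \<le> b \<longrightarrow>
       tv_dist (posterior \<theta> h) (posterior \<theta> h')
         \<le> min (2 * (1 - 2 powr (- b))) (sqrt (2 powr (b + 1) * gestalt_complexity S \<theta> x \<epsilon>)))"
proof -
  \<comment> \<open>The shared stimulus gives \<open>h \<inter> h'\<close> positive mass, so
    conditioning on it makes sense.\<close>
  have "measure_pmf.prob \<theta> {z. fst z = x} \<le> rect_prob \<theta> (h \<inter> h')"
    unfolding rect_prob_def using assms(6) by (intro measure_pmf.finite_measure_mono) auto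
  with assms(3) have pos: "rect_prob \<theta> (h \<inter> h') > 0" by simp
  have g: "mutual_info_given \<theta> h fst snd \<le> gestalt_complexity S \<theta> x \<epsilon>"
    "mutual_info_given \<theta> h' fst snd \<le> gestalt_complexity S \<theta> x \<epsilon>"
    using assms by (auto intro: mutual_info_le_gestalt_complexity)
  show ?thesis
    using ell_le_switching_cost[OF assms(1,4,5) pos]
      tv_dist_le_of_switching_cost[OF assms(1,4,5) pos _ _ _ g] by auto
qed

end
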